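(* The amoeba-Silver forcing $\mathbf{AV}$ does not have pure decision. That is, it is not the case that for every formula $\varphi$ of the forcing language of $\mathbf{AV}$ and every condition $(p,T)\in\mathbf{AV}$ there is a Silver tree $T'\subseteq T$ with $(p,T')\in\mathbf{AV}$, $(p,T')\le(p,T)$, and either $(p,T')\Vdash\varphi$ or $(p,T')\Vdash\neg\varphi$.
   Context: A tree is a subset of $2^{<\omega}$ closed under initial segments. For a tree $T$ and $n\in\omega$, $T|n:=\{t\in T: |t|\le n\}$. A tree $T\subseteq 2^{<\omega}$ is perfect if every node of $T$ can be extended to a splitting node of $T$ (a node $t\in T$ with both $t^\frown 0\in T$ and $t^\frown 1\in T$). A perfect tree $T$ is a Silver tree if for all $s,t\in T$ with $|s|=|t|$ and each $i\in\{0,1\}$: $s^\frown i\in T \Leftrightarrow t^\frown i\in T$. For a finite tree $p$, its height is $\mathrm{ht}(p):=\max\{n:\exists t\in p,\ |t|=n\}$. Amoeba-Silver $\mathbf{AV}$ is the poset of all pairs $(p,T)$ such that $T$ is a Silver tree and $p=T|n$ for some $n\in\omega$, ordered by $(p',T')\le(p,T)$ iff $T'\subseteq T$ and $p'|\mathrm{ht}(p)=p$. *)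

theory Defs
  imports Main "HOL-Library.Sublist"
begin

section \<open>Silver trees\<close>

definition is_tree :: "bool list set \<Rightarrow> bool" where
  "is_tree T \<longleftrightarrow> (\<forall>t\<in>T. \<forall>s. prefix s t \<longrightarrow> s \<in> T)"

definition restr :: "bool list set \<Rightarrow> nat \<Rightarrow> bool list set" where
  "restr T n = {t \<in> T. length t \<le> n}"

definition splitting :: "bool list set \<Rightarrow> bool list \<Rightarrow> bool" where
  "splitting T t \<longleftrightarrow> t \<in> T \<and> t @ [False] \<in> T \<and> t @ [True] \<in> T"

text \<open>Perfect trees are nonempty by convention; otherwise the empty tree would vacuously be
  perfect, and the height of its restrictions would be undefined.\<close>

definition perfect_tree :: "bool list set \<Rightarrow> bool" where
  "perfect_tree T \<longleftrightarrow> is_tree T \<and> T \<noteq> {} \<and> (\<forall>t\<in>T. \<exists>s. prefix t s \<and> splitting T s)"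

definition silver_tree :: "bool list set \<Rightarrow> bool" where
  "silver_tree T \<longleftrightarrow> perfect_tree T \<and>
     (\<forall>s\<in>T. \<forall>t\<in>T. length s = length t \<longrightarrow> (\<forall>i. s @ [i] \<in> T \<longleftrightarrow> t @ [i] \<in> T))"

definition ht :: "bool list set \<Rightarrow> nat" where
  "ht p = Max {n. \<exists>t\<in>p. length t = n}"

section \<open>Amoeba-Silver forcing\<close>

typedef amoeba_silver = "{(p, T). silver_tree T \<and> (\<exists>n. p = restr T n)}"
proof -
  have "silver_tree UNIV"
    by (auto simp: silver_tree_def perfect_tree_def is_tree_def splitting_def)
  then show ?thesis by blast
qed

definition stem :: "amoeba_silver \<Rightarrow> bool list set" where
  "stem c = fst (Rep_amoeba_silver c)"

definition tree :: "amoeba_silver \<Rightarrow> bool list set" where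
  "tree c = snd (Rep_amoeba_silver c)"

lemma silver_tree_tree: "silver_tree (tree c)"
  and stem_eq_restr: "\<exists>n. stem c = restr (tree c) n"
  using Rep_amoeba_silver[of c] by (auto simp: stem_def tree_def)

lemma amoeba_silver_eqI: "stem c = stem d \<Longrightarrow> tree c = tree d \<Longrightarrow> c = d"
  by (simp add: stem_def tree_def prod_eq_iff flip: Rep_amoeba_silver_inject)

lemma finite_stem: "finite (stem c)"
proof -
  obtain n where "stem c = restr (tree c) n" using stem_eq_restr by blast
  then have "stem c \<subseteq> {xs. set xs \<subseteq> UNIV \<and> length xs \<le> n}" by (auto simp: restr_def)
  then show ?thesis by (rule finite_subset) (rule finite_lists_length_le[OF finite])
qed

lemma Nil_in_stem: "[] \<in> stem c"
proof -
  have "is_tree (tree c)" "tree c \<noteq> {}"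
    using silver_tree_tree[of c] unfolding silver_tree_def perfect_tree_def by blast+
  then have "[] \<in> tree c" unfolding is_tree_def using Nil_prefix by blast
  moreover obtain n where "stem c = restr (tree c) n" using stem_eq_restr by blast
  ultimately show ?thesis by (simp add: restr_def)
qed

lemma ht_image: "ht p = Max (length ` p)"
  unfolding ht_def by (rule arg_cong[where f = Max]) auto

lemma length_le_ht: "t \<in> stem c \<Longrightarrow> length t \<le> ht (stem c)"
  by (simp add: ht_image finite_stem)

lemma restr_ht [simp]: "restr (stem c) (ht (stem c)) = stem c"
  using length_le_ht by (auto simp: restr_def)

lemma ht_mono: "stem c \<subseteq> stem d \<Longrightarrow> ht (stem c) \<le> ht (stem d)"
  unfolding ht_image using Nil_in_stem finite_stem by (intro Max_mono) auto

instantiation amoeba_silver :: order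
begin

definition less_eq_amoeba_silver :: "amoeba_silver \<Rightarrow> amoeba_silver \<Rightarrow> bool" where
  "c' \<le> c \<longleftrightarrow> tree c' \<subseteq> tree c \<and> restr (stem c') (ht (stem c)) = stem c"

definition less_amoeba_silver :: "amoeba_silver \<Rightarrow> amoeba_silver \<Rightarrow> bool" where
  "less_amoeba_silver c' c \<longleftrightarrow> c' \<le> c \<and> \<not> c \<le> c'"

instance
proof
  have sub: "stem c \<subseteq> stem c'" if "c' \<le> c" for c c'
    using that by (auto simp: less_eq_amoeba_silver_def restr_def)
  fix a b c :: amoeba_silver
  show "a < b \<longleftrightarrow> a \<le> b \<and> \<not> b \<le> a" by (rule less_amoeba_silver_def)
  show "a \<le> a" by (simp add: less_eq_amoeba_silver_def)
  show "a \<le> c" if "a \<le> b" "b \<le> c"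
  proof -
    have "ht (stem c) \<le> ht (stem b)" using ht_mono sub that(2) by blast
    then have "restr (stem a) (ht (stem c))
        = restr (restr (stem a) (ht (stem b))) (ht (stem c))"
      by (auto simp: restr_def)
    then show ?thesis using that by (auto simp: less_eq_amoeba_silver_def)
  qed
  show "a = b" if "a \<le> b" "b \<le> a"
    using that sub amoeba_silver_eqI[of a b]
    by (auto simp: less_eq_amoeba_silver_def)
qed

end

section \<open>The forcing language and the forcing relation\<close>

text \<open>A name is a set of pairs of a name and a condition. Since HOL has no type of all names,
  such a set is presented here as the range of a partial map with index type \<open>'i + 'c\<close>: the
  type contains all names that are hereditarily of size at most that of \<open>'i + 'c\<close>. The
  parameter \<open>'i\<close> is arbitrary; the summand \<open>'c\<close> makes every set of conditions available as
  an index set whatever \<open>'i\<close> is.\<close>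

datatype ('i, 'c) pname = PName "'i + 'c \<Rightarrow> (('i, 'c) pname \<times> 'c) option"

primrec elems :: "('i, 'c) pname \<Rightarrow> (('i, 'c) pname \<times> 'c) set" where
  "elems (PName f) = ran f"

lemma wf_elems: "wf {(\<sigma>, \<tau>). \<exists>s. (\<sigma>, s) \<in> elems \<tau>}"
proof (rule wfUNIVI)
  fix P :: "('i, 'c) pname \<Rightarrow> bool" and \<tau>
  assume *: "\<forall>x. (\<forall>y. (y, x) \<in> {(\<sigma>, \<tau>). \<exists>s. (\<sigma>, s) \<in> elems \<tau>} \<longrightarrow> P y) \<longrightarrow> P x"
  show "P \<tau>"
  proof (induction \<tau>)
    case (PName f)
    have "P \<sigma>" if mem: "(\<sigma>, s) \<in> elems (PName f)" for \<sigma> s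
    proof -
      obtain i where "f i = Some (\<sigma>, s)" using mem by (auto simp: ran_def)
      then show ?thesis
        using PName[of "Some (\<sigma>, s)" "(\<sigma>, s)" \<sigma>]
        by (metis fst_conv fsts.intros option.set_intros rangeI)
    qed
    then show ?case using * by blast
  qed
qed

text \<open>\<open>dense_below p D\<close> does not require \<open>D\<close> to consist of conditions below \<open>p\<close>.\<close>

definition dense_below :: "'c::preorder \<Rightarrow> 'c set \<Rightarrow> bool" where
  "dense_below p D \<longleftrightarrow> (\<forall>q\<le>p. \<exists>r\<le>q. r \<in> D)"

text \<open>The forcing relation is given by the usual recursion in the ground model
  (Kunen, Set Theory, 1980, Definition VII.3.3).\<close>

function forces_eq :: "'c::preorder \<Rightarrow> ('i, 'c) pname \<Rightarrow> ('i, 'c) pname \<Rightarrow> bool" where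
  "forces_eq p \<tau>\<^sub>1 \<tau>\<^sub>2 \<longleftrightarrow>
     (\<forall>(\<pi>\<^sub>1, s\<^sub>1) \<in> elems \<tau>\<^sub>1. dense_below p
        {q. q \<le> s\<^sub>1 \<longrightarrow> (\<exists>(\<pi>\<^sub>2, s\<^sub>2) \<in> elems \<tau>\<^sub>2. q \<le> s\<^sub>2 \<and> forces_eq q \<pi>\<^sub>1 \<pi>\<^sub>2)}) \<and>
     (\<forall>(\<pi>\<^sub>2, s\<^sub>2) \<in> elems \<tau>\<^sub>2. dense_below p
        {q. q \<le> s\<^sub>2 \<longrightarrow> (\<exists>(\<pi>\<^sub>1, s\<^sub>1) \<in> elems \<tau>\<^sub>1. q \<le> s\<^sub>1 \<and> forces_eq q \<pi>\<^sub>1 \<pi>\<^sub>2)})"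
  by pat_completeness auto
termination
  by (relation "inv_image {(\<sigma>, \<tau>). \<exists>s. (\<sigma>, s) \<in> elems \<tau>} (\<lambda>(p, \<tau>\<^sub>1, \<tau>\<^sub>2). \<tau>\<^sub>1)")
    (auto intro: wf_elems wf_inv_image)

declare forces_eq.simps [simp del]

definition forces_mem :: "'c::preorder \<Rightarrow> ('i, 'c) pname \<Rightarrow> ('i, 'c) pname \<Rightarrow> bool" where
  "forces_mem p \<pi> \<tau> \<longleftrightarrow>
     dense_below p {q. \<exists>(\<sigma>, s) \<in> elems \<tau>. q \<le> s \<and> forces_eq q \<pi> \<sigma>}"

text \<open>A formula of the forcing language is a formula of set theory together with an assignment
  of names to its variables.\<close>

datatype fm = Mem nat nat | Eq nat nat | Neg fm | Conj fm fm | Ex nat fm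

primrec forces :: "'c::preorder \<Rightarrow> fm \<Rightarrow> (nat \<Rightarrow> ('i, 'c) pname) \<Rightarrow> bool" where
  "forces p (Mem x y) e \<longleftrightarrow> forces_mem p (e x) (e y)"
| "forces p (Eq x y) e \<longleftrightarrow> forces_eq p (e x) (e y)"
| "forces p (Neg \<phi>) e \<longleftrightarrow> \<not> (\<exists>q\<le>p. forces q \<phi> e)"
| "forces p (Conj \<phi> \<psi>) e \<longleftrightarrow> forces p \<phi> e \<and> forces p \<psi> e"
| "forces p (Ex x \<phi>) e \<longleftrightarrow> dense_below p {q. \<exists>\<sigma>. forces q \<phi> (e(x := \<sigma>))}"

end

theory Submission
  imports Defs
begin

text \<open>
  The sentence that no pure extension decides is: the stem of the generic tree has an even number
  of ones. Here the stem of a Silver tree, called its trunk below, is the node that splits and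
  that every splitting node extends. The sentence takes the form \<open>\<emptyset> \<in> \<tau>\<close>, where \<open>\<tau>\<close> collects
  the conditions whose finite part already exhibits an even trunk.

  Take a condition whose finite part consists of the root only, with Silver tree \<open>T\<close>. Choose a
  splitting node \<open>t\<close> of \<open>T\<close> and a splitting node \<open>t\<^sup>\<frown>0\<^sup>\<frown>w\<close> above it. By uniformity of \<open>T\<close>,
  \<open>t\<^sup>\<frown>1\<^sup>\<frown>w\<close> splits as well. Either of the two nodes can be made the trunk of a Silver subtree,
  and the numbers of ones in them differ by one, so \<open>T\<close> leaves both parities possible
  (\<open>trunk_parity_free\<close>). A pure extension of such a condition is again of this form, and so decides
  no more. On the other hand, once a trunk lies in the finite part of a
  condition, it is the trunk of every stronger condition, so conditions with different trunk
  parities are incompatible (\<open>trunk_unique\<close>).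
\<close>

section \<open>Subtrees of a Silver tree\<close>

definition cone :: "bool list set \<Rightarrow> bool list \<Rightarrow> bool list set" where
  "cone T t = {u \<in> T. prefix u t \<or> prefix t u}"

lemma is_tree_append: "is_tree T \<Longrightarrow> s @ w \<in> T \<Longrightarrow> s \<in> T"
  by (auto simp: is_tree_def)

lemma silver_tree_is_tree: "silver_tree T \<Longrightarrow> is_tree T"
  by (simp add: silver_tree_def perfect_tree_def)

lemma silver_tree_append:
  assumes T: "silver_tree T" and st: "s \<in> T" "t \<in> T" "length s = length t"
  shows "s @ w \<in> T \<longleftrightarrow> t @ w \<in> T"
proof (induction w rule: rev_induct)
  case Nil
  then show ?case using st by simp
next
  case (snoc i w)
  show ?case
  proof (cases "s @ w \<in> T")
    case True
    then have "(s @ w) @ [i] \<in> T \<longleftrightarrow> (t @ w) @ [i] \<in> T"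
      using snoc T st unfolding silver_tree_def by (metis length_append)
    then show ?thesis by simp
  next
    case False
    then show ?thesis
      using snoc is_tree_append[OF silver_tree_is_tree[OF T]] by (metis append.assoc)
  qed
qed

lemma splitting_silver_tree_append:
  assumes "silver_tree T" "s \<in> T" "t \<in> T" "length s = length t" "splitting T (s @ w)"
  shows "splitting T (t @ w)"
  using assms silver_tree_append[OF assms(1-4)] by (simp add: splitting_def)

lemma silver_tree_cone:
  assumes T: "silver_tree T" and t: "t \<in> T"
  shows "silver_tree (cone T t)"
proof -
  have tree: "is_tree (cone T t)"
    unfolding is_tree_def
  proof (intro ballI allI impI)
    fix u s assume u: "u \<in> cone T t" and s: "prefix s u"
    have "s \<in> T"
      using silver_tree_is_tree[OF T] u s unfolding is_tree_def cone_def by blast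
    moreover have "prefix s t \<or> prefix t s"
      using u s prefix_order.trans[of s u t] prefix_same_cases[of s u t] unfolding cone_def by blast
    ultimately show "s \<in> cone T t" by (simp add: cone_def)
  qed
  have ne: "cone T t \<noteq> {}" using t by (auto simp: cone_def)
  have perf: "\<exists>s. prefix u s \<and> splitting (cone T t) s" if u: "u \<in> cone T t" for u
  proof -
    obtain v where v: "prefix u v" "prefix t v" "v \<in> T"
      using u t by (auto simp: cone_def)
    then obtain s where s: "prefix v s" "splitting T s"
      using T unfolding silver_tree_def perfect_tree_def by blast
    then have "prefix t s" using v by (meson prefix_order.trans)
    then have "splitting (cone T t) s" using s by (auto simp: splitting_def cone_def)
    then show ?thesis using v s by (meson prefix_order.trans)
  qed
  have unif: "s @ [i] \<in> cone T t"
    if m: "r @ [i] \<in> cone T t" "s \<in> cone T t" and r: "r \<in> cone T t" "length r = length s" for r s i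
  proof (cases "length r < length t")
    case True
    \<comment> \<open>Below the apex, a level of the cone has just one node.\<close>
    then have "prefix r t" "prefix s t" using m r by (auto simp: cone_def dest: prefix_length_le)
    then have "r = s" using r by (metis prefix_length_prefix prefix_order.antisym order.refl)
    then show ?thesis using m by simp
  next
    case False
    then have "prefix t s"
      using m r by (auto simp: cone_def prefix_def)
    moreover have "s @ [i] \<in> T"
      using silver_tree_append[OF T, of r s "[i]"] m r by (auto simp: cone_def)
    ultimately show ?thesis by (simp add: cone_def)
  qed
  show ?thesis
    unfolding silver_tree_def perfect_tree_def
  proof (intro conjI ballI allI impI iffI)
    show "\<exists>s. prefix u s \<and> splitting (cone T t) s" if "u \<in> cone T t" for u
      using perf that .
    show "s @ [i] \<in> cone T t"
      if "r \<in> cone T t" "s \<in> cone T t" "length r = length s" "r @ [i] \<in> cone T t" for r s i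
      using unif that by blast
    show "r @ [i] \<in> cone T t"
      if "r \<in> cone T t" "s \<in> cone T t" "length r = length s" "s @ [i] \<in> cone T t" for r s i
      using unif[of s i r] that by simp
  qed (use tree ne in auto)
qed

section \<open>Trunks\<close>

definition ones :: "bool list \<Rightarrow> nat" where
  "ones t = length (filter id t)"

text \<open>The trunk must split inside the finite part, and not only in the tree: this is what makes
  it persist to stronger conditions.\<close>

definition trunk :: "amoeba_silver \<Rightarrow> bool list \<Rightarrow> bool" where
  "trunk c t \<longleftrightarrow> splitting (stem c) t \<and> (\<forall>u. splitting (tree c) u \<longrightarrow> prefix t u)"

lemma splitting_mono: "splitting S t \<Longrightarrow> S \<subseteq> T \<Longrightarrow> splitting T t"
  by (auto simp: splitting_def)

lemma stem_subset_tree: "stem c \<subseteq> tree c"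
  using stem_eq_restr[of c] by (auto simp: restr_def)

text \<open>A common extension keeps the splitting of \<open>t\<close> and of \<open>t'\<close>, and its splitting nodes also
  split in the trees of \<open>c\<close> and \<open>c'\<close>; so each of the two trunks is a prefix of the other.\<close>

lemma trunk_unique:
  assumes "trunk c t" "trunk c' t'" "r \<le> c" "r \<le> c'"
  shows "t = t'"
proof -
  have split: "splitting (tree r) t" if "trunk c t" "r \<le> c" for c t
  proof -
    have "stem c \<subseteq> stem r" using that by (auto simp: less_eq_amoeba_silver_def restr_def)
    then show ?thesis
      using that stem_subset_tree[of r] by (meson splitting_mono subset_trans trunk_def)
  qed
  have "prefix t u" if "trunk c t" "r \<le> c" "splitting (tree r) u" for c t u
    using that by (meson less_eq_amoeba_silver_def splitting_mono trunk_def)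
  then show ?thesis
    using assms split by (meson prefix_order.antisym)
qed

lemma amoeba_silver_exists:
  assumes "silver_tree T"
  obtains c where "stem c = restr T n" "tree c = T"
proof
  have "Rep_amoeba_silver (Abs_amoeba_silver (restr T n, T)) = (restr T n, T)"
    using assms by (intro Abs_amoeba_silver_inverse) blast
  then show "stem (Abs_amoeba_silver (restr T n, T)) = restr T n"
    and "tree (Abs_amoeba_silver (restr T n, T)) = T"
    by (simp_all add: stem_def tree_def)
qed

lemma le_of_root_stem:
  assumes "stem c = {[]}" "tree s \<subseteq> tree c"
  shows "s \<le> c"
  using assms Nil_in_stem[of s] by (auto simp: less_eq_amoeba_silver_def restr_def ht_def)

text \<open>Any splitting node of the tree can become the trunk, since a cone has no splitting node
  strictly below its apex.\<close>

lemma trunk_at_splitting: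
  assumes c: "stem c = {[]}" and t: "splitting (tree c) t"
  obtains s where "s \<le> c" "trunk s t"
proof -
  have T: "silver_tree (cone (tree c) t)"
    using t silver_tree_tree by (auto simp: splitting_def intro: silver_tree_cone)
  \<comment> \<open>The successors of \<open>t\<close> must belong to the finite part, which therefore extends one level
    beyond \<open>t\<close>.\<close>
  obtain s where s: "stem s = restr (cone (tree c) t) (Suc (length t))" "tree s = cone (tree c) t"
    using amoeba_silver_exists[OF T] by blast
  have le: "s \<le> c" using c s by (auto intro: le_of_root_stem simp: cone_def)
  have "splitting (stem s) t" using t s by (auto simp: splitting_def restr_def cone_def)
  moreover have "prefix t u" if u: "splitting (tree s) u" for u
  proof (rule ccontr)
    assume not: "\<not> prefix t u"
    have "prefix (u @ [i]) t" for i
    proof -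
      have "u @ [i] \<in> cone (tree c) t" using u s by (cases i) (auto simp: splitting_def)
      then show ?thesis using not by (auto simp: cone_def)
    qed
    then have "prefix (u @ [False]) t" "prefix (u @ [True]) t" by blast+
    then show False by (auto simp: prefix_def)
  qed
  ultimately show thesis using that le by (simp add: trunk_def)
qed

lemma trunk_parity_free:
  assumes c: "stem c = {[]}"
  obtains s t where "s \<le> c" "trunk s t" "even (ones t) \<longleftrightarrow> b"
proof -
  let ?T = "tree c"
  have T: "silver_tree ?T" by (rule silver_tree_tree)
  then have perf: "\<exists>s. prefix t s \<and> splitting ?T s" if "t \<in> ?T" for t
    using that unfolding silver_tree_def perfect_tree_def by blast
  have "[] \<in> ?T" using Nil_in_stem stem_subset_tree by blast
  then obtain t where t: "splitting ?T t" using perf by blast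
  then obtain w where w: "splitting ?T ((t @ [False]) @ w)"
    using perf by (metis prefix_def splitting_def)
  have w': "splitting ?T ((t @ [True]) @ w)"
    by (rule splitting_silver_tree_append[OF T _ _ _ w]) (use t in \<open>auto simp: splitting_def\<close>)
  have "ones ((t @ [True]) @ w) = Suc (ones ((t @ [False]) @ w))"
    by (simp add: ones_def)
  then obtain v where "splitting ?T v" "even (ones v) \<longleftrightarrow> b"
    using w w' by (metis even_Suc)
  then show thesis using trunk_at_splitting[OF c] that by metis
qed

section \<open>Forcing that a set of conditions meets the generic filter\<close>

definition empty_name :: "('i, 'c) pname" where
  "empty_name = PName (\<lambda>_. None)"

definition set_name :: "'c set \<Rightarrow> ('i, 'c) pname" where
  "set_name D = PName (\<lambda>x. case x of Inl _ \<Rightarrow> None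
                                  | Inr s \<Rightarrow> if s \<in> D then Some (empty_name, s) else None)"

lemma elems_set_name: "elems (set_name D) = {empty_name} \<times> D"
  by (auto simp: set_name_def ran_def split_sum_ex split: if_splits)

text \<open>All elements of \<open>set_name D\<close> are names of the empty set, so that the membership holds in
  an extension exactly if \<open>D\<close> meets the generic filter.\<close>

lemma forces_mem_set_name:
  "forces_mem p (empty_name :: ('i, 'c::preorder) pname) (set_name D)
     \<longleftrightarrow> dense_below p {q. \<exists>s\<in>D. q \<le> s}"
proof -
  have "forces_eq q (empty_name :: ('i, 'c) pname) empty_name" for q
    by (subst forces_eq.simps) (simp add: empty_name_def)
  then show ?thesis by (simp add: forces_mem_def elems_set_name)
qed

section \<open>The failure of pure decision\<close>

theorem mainTheorem2:
  "\<not> (\<forall>(\<phi> :: fm) (e :: nat \<Rightarrow> ('i, amoeba_silver) pname) (c :: amoeba_silver).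
        \<exists>c' :: amoeba_silver. tree c' \<subseteq> tree c \<and> stem c' = stem c \<and> c' \<le> c \<and>
          (forces c' \<phi> e \<or> forces c' (Neg \<phi>) e))"
proof
  assume pure: "\<forall>(\<phi> :: fm) (e :: nat \<Rightarrow> ('i, amoeba_silver) pname) (c :: amoeba_silver).
        \<exists>c' :: amoeba_silver. tree c' \<subseteq> tree c \<and> stem c' = stem c \<and> c' \<le> c \<and>
          (forces c' \<phi> e \<or> forces c' (Neg \<phi>) e)"
  define D where "D = {s. \<exists>t. trunk s t \<and> even (ones t)}"
  define e :: "nat \<Rightarrow> ('i, amoeba_silver) pname"
    where "e n = (if n = 0 then empty_name else set_name D)" for n
  have forces_iff: "forces p (Mem 0 1) e \<longleftrightarrow> dense_below p {q. \<exists>s\<in>D. q \<le> s}" for p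
    by (simp add: e_def forces_mem_set_name)
  have "silver_tree UNIV"
    by (auto simp: silver_tree_def perfect_tree_def is_tree_def splitting_def)
  then obtain c where c: "stem c = restr UNIV 0" using amoeba_silver_exists by blast
  obtain c' where c': "stem c' = stem c" "forces c' (Mem 0 1) e \<or> forces c' (Neg (Mem 0 1)) e"
    using pure by blast
  have root: "stem c' = {[]}" using c c' by (auto simp: restr_def)
  from c'(2) show False
  proof
    assume "forces c' (Mem 0 1) e"
    moreover obtain s t where s: "s \<le> c'" "trunk s t" "odd (ones t)"
      using trunk_parity_free[OF root, of False] by auto
    ultimately obtain r s' where "r \<le> s" "s' \<in> D" "r \<le> s'"
      unfolding forces_iff dense_below_def by blast
    moreover from \<open>s' \<in> D\<close> obtain t' where "trunk s' t'" "even (ones t')"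
      unfolding D_def by blast
    ultimately show False using s trunk_unique by metis
  next
    assume "forces c' (Neg (Mem 0 1)) e"
    moreover obtain s t where "s \<le> c'" "trunk s t" "even (ones t)"
      using trunk_parity_free[OF root, of True] by auto
    moreover from this have "forces s (Mem 0 1) e"
      unfolding forces_iff dense_below_def D_def by blast
    ultimately show False unfolding forces.simps(3) by blast
  qed
qed

end
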